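(* Let $I\subseteq\mathbb{R}$ be an interval, $G:I\to(0,1)$ a continuous strictly increasing bijection, and $X,X_1,\ldots,X_n$ ($n\ge1$) i.i.d. with law $P$, $P(I)=1$. For an integer $q\ge1$ and $r=1,\ldots,q$ let $p_r=\mathbb{E}[G(X)^r]$, $\widehat p_r=\frac1n\sum_{i=1}^nG(X_i)^r$ and $M_r=G^{-1}(p_r)$. For $\alpha\in(0,1)$ let $\varepsilon_{n,\alpha,q}=\sqrt{\log(2q/\alpha)/(2n)}$. Then $$\mathbb{P}\left(|\widehat p_r-p_r|\le\varepsilon_{n,\alpha,q}\text{ for all }r=1,\ldots,q\right)\ge1-\alpha.$$ Thus the intervals $J_r=[\widehat p_r-\varepsilon_{n,\alpha,q},\widehat p_r+\varepsilon_{n,\alpha,q}]\cap[0,1]$ satisfy $\mathbb{P}(p_r\in J_r\text{ for all }r=1,\ldots,q)\ge1-\alpha$, and $\mathbb{P}(M_r\in G^{-1}(J_r)\text{ for all }r=1,\ldots,q)\ge1-\alpha$.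
   Context: The inverse is extended by $G^{-1}(0)=\inf I$, $G^{-1}(1)=\sup I$ (possibly $\mp\infty$), and $G^{-1}(J)$ is the image of $J\subseteq[0,1]$ under this extended inverse. The $p_r$ are the initial coordinate moments and the $M_r$ the initial Kolmogorov moments. *)

theory Defs
  imports "HOL-Probability.Probability"
begin

text \<open>
  The map \<open>G\<close> is only meaningful on \<open>I\<close>, while a random variable with law \<open>P\<close>, \<open>P(I) = 1\<close>, may
  leave \<open>I\<close> on a null event. There \<open>G(X)\<close> is read as \<open>0\<close>; this makes it measurable and affects no
  probability or expectation.
\<close>
definition zero_off :: "real set \<Rightarrow> (real \<Rightarrow> real) \<Rightarrow> real \<Rightarrow> real" where
  "zero_off I G x = (if x \<in> I then G x else 0)"

definition coord_moment ::
    "'a measure \<Rightarrow> real set \<Rightarrow> (real \<Rightarrow> real) \<Rightarrow> ('a \<Rightarrow> real) \<Rightarrow> nat \<Rightarrow> real" where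
  "coord_moment M I G X r = (\<integral>\<omega>. zero_off I G (X \<omega>) ^ r \<partial>M)"

definition emp_moment ::
    "real set \<Rightarrow> (real \<Rightarrow> real) \<Rightarrow> (nat \<Rightarrow> 'a \<Rightarrow> real) \<Rightarrow> nat \<Rightarrow> nat \<Rightarrow> 'a \<Rightarrow> real" where
  "emp_moment I G Xs n r \<omega> = (1 / real n) * (\<Sum>i=1..n. zero_off I G (Xs i \<omega>) ^ r)"

definition kolm_moment ::
    "'a measure \<Rightarrow> real set \<Rightarrow> (real \<Rightarrow> real) \<Rightarrow> ('a \<Rightarrow> real) \<Rightarrow> nat \<Rightarrow> real" where
  "kolm_moment M I G X r = the_inv_into I G (coord_moment M I G X r)"

text \<open>
  The inverse of \<open>G\<close> extended to \<open>[0,1]\<close>; infimum and supremum are taken in the extended reals,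
  so they are infinite when \<open>I\<close> is unbounded.
\<close>
definition ext_inv :: "real set \<Rightarrow> (real \<Rightarrow> real) \<Rightarrow> real \<Rightarrow> ereal" where
  "ext_inv I G u =
    (if u = 0 then Inf (ereal ` I)
     else if u = 1 then Sup (ereal ` I)
     else ereal (the_inv_into I G u))"

definition conf_radius :: "nat \<Rightarrow> real \<Rightarrow> nat \<Rightarrow> real" where
  "conf_radius n \<alpha> q = sqrt (ln (2 * real q / \<alpha>) / (2 * real n))"

definition conf_interval ::
    "real set \<Rightarrow> (real \<Rightarrow> real) \<Rightarrow> (nat \<Rightarrow> 'a \<Rightarrow> real) \<Rightarrow> nat \<Rightarrow> real \<Rightarrow> nat \<Rightarrow> nat \<Rightarrow> 'a \<Rightarrow> real set" where
  "conf_interval I G Xs n \<alpha> q r \<omega> =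
    {emp_moment I G Xs n r \<omega> - conf_radius n \<alpha> q .. emp_moment I G Xs n r \<omega> + conf_radius n \<alpha> q}
      \<inter> {0..1}"

end

theory Submission
  imports Defs
begin

text \<open>
  For each fixed \<open>r\<close> the variables \<open>G(X\<^sub>i)\<^sup>r\<close> are i.i.d. in \<open>[0,1]\<close>, so Hoeffding's inequality bounds
  the probability of a deviation of at least the radius by \<open>2 exp (-2 n \<epsilon>\<^sup>2) = \<alpha>/q\<close>, and a union bound over the \<open>q\<close> moments
  gives the first claim. The other two events coincide with the first one: the moments lie strictly
  between 0 and 1, where the extended inverse of \<open>G\<close> is injective even against the endpoint
  values, because \<open>I\<close> contains neither its infimum nor its supremum.
\<close>

text \<open>All statistics \<open>f r\<close> are averaged over one sample, so their deviations are
  dependent across \<open>r\<close>; the union bound is insensitive to this. The moments are the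
  case where \<open>f r\<close> is the \<open>r\<close>-th power of
  \<open>zero_off I G\<close>.\<close>

lemma (in prob_space) Hoeffding_simultaneous:
  fixes X :: "'i \<Rightarrow> 'a \<Rightarrow> 'b::topological_space" and f :: "'r \<Rightarrow> 'b \<Rightarrow> real"
  assumes indep: "indep_vars (\<lambda>_. borel) X I" and I: "finite I" "I \<noteq> {}"
    and Y: "random_variable borel Y"
    and distr: "\<And>i. i \<in> I \<Longrightarrow> distr M borel (X i) = distr M borel Y"
    and R: "finite R" "R \<noteq> {}"
    and f: "\<And>r. r \<in> R \<Longrightarrow> f r \<in> borel_measurable borel"
    and f01: "\<And>r x. r \<in> R \<Longrightarrow> f r x \<in> {0..1}"
    and \<alpha>: "0 < \<alpha>" "\<alpha> \<le> 1"
  shows "prob {\<omega> \<in> space M. \<forall>r\<in>R. \<bar>(\<Sum>i\<in>I. f r (X i \<omega>)) / card I - expectation (\<lambda>\<omega>. f r (Y \<omega>))\<bar>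
           \<le> sqrt (ln (2 * card R / \<alpha>) / (2 * card I))} \<ge> 1 - \<alpha>"
proof -
  define \<epsilon> where "\<epsilon> = sqrt (ln (2 * card R / \<alpha>) / (2 * card I))"
  define D where "D r \<omega> = \<bar>(\<Sum>i\<in>I. f r (X i \<omega>)) / card I - expectation (\<lambda>\<omega>. f r (Y \<omega>))\<bar>" for r \<omega>
  have cI: "card I > 0" and cR: "card R > 0"
    using I R by (auto simp: card_gt_0_iff)
  \<comment> \<open>This makes the logarithm nonnegative, so that \<epsilon> is a genuine root: it
    is nonnegative and its square gives back the quotient under the root.\<close>
  have ge1: "2 * real (card R) / \<alpha> \<ge> 1"
    using cR \<alpha> by (simp add: field_simps)
  have \<epsilon>0: "\<epsilon> \<ge> 0"
    using ge1 cI by (auto simp: \<epsilon>_def)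
  have X: "random_variable borel (X i)" if "i \<in> I" for i
    using indep that unfolding indep_vars_def by blast
  have fX: "(\<lambda>\<omega>. f r (X i \<omega>)) \<in> borel_measurable M" if "r \<in> R" "i \<in> I" for r i
    using measurable_compose[OF X f] that by simp
  have D: "D r \<in> borel_measurable M" if "r \<in> R" for r
  proof -
    have [measurable]: "(\<lambda>\<omega>. \<Sum>i\<in>I. f r (X i \<omega>)) \<in> borel_measurable M"
      using fX that by (intro borel_measurable_sum) auto
    show ?thesis unfolding D_def by measurable
  qed
  have single: "prob {\<omega> \<in> space M. D r \<omega> \<ge> \<epsilon>} \<le> \<alpha> / card R" if r: "r \<in> R" for r
  proof -
    interpret Hoeffding_ineq_iid M I "\<lambda>i \<omega>. f r (X i \<omega>)" "\<lambda>\<omega>. f r (Y \<omega>)" 0 1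
      "expectation (\<lambda>\<omega>. f r (Y \<omega>))"
    proof unfold_locales
      show "indep_vars (\<lambda>_. borel) (\<lambda>i \<omega>. f r (X i \<omega>)) I"
        using f[OF r] by (intro indep_vars_compose2[OF indep])
      show "(\<lambda>\<omega>. f r (Y \<omega>)) \<in> borel_measurable M"
        using measurable_compose[OF Y f[OF r]] .
      fix i assume i: "i \<in> I"
      have "distr M borel (\<lambda>\<omega>. f r (X i \<omega>)) = distr (distr M borel (X i)) borel (f r)"
        using distr_distr[OF f[OF r] X[OF i]] by (simp add: o_def)
      also have "\<dots> = distr M borel (\<lambda>\<omega>. f r (Y \<omega>))"
        using distr_distr[OF f[OF r] Y] by (simp add: o_def distr[OF i])
      finally show "distr M borel (\<lambda>\<omega>. f r (X i \<omega>)) = distr M borel (\<lambda>\<omega>. f r (Y \<omega>))" .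
    qed (use I f01[OF r] in auto)
    have "prob {\<omega> \<in> space M. D r \<omega> \<ge> \<epsilon>} \<le> 2 * exp (- 2 * card I * \<epsilon>\<^sup>2)"
      using Hoeffding_ineq_abs_ge'[OF \<epsilon>0 _ I(2)] unfolding D_def by simp
    also have "- 2 * card I * \<epsilon>\<^sup>2 = - ln (2 * card R / \<alpha>)"
      using cI ge1 by (simp add: \<epsilon>_def)
    also have "2 * exp \<dots> = \<alpha> / card R"
      using cR \<alpha> by (simp add: exp_minus)
    finally show ?thesis .
  qed
  let ?A = "{\<omega> \<in> space M. \<forall>r\<in>R. D r \<omega> \<le> \<epsilon>}"
  have A: "?A \<in> events"
    using D R by measurable
  have B: "{\<omega> \<in> space M. D r \<omega> \<ge> \<epsilon>} \<in> events" if "r \<in> R" for r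
    using D[OF that] by measurable
  have "1 - prob ?A = prob (space M - ?A)"
    using prob_compl[OF A] by simp
  \<comment> \<open>Outside \<open>?A\<close> some deviation strictly exceeds \<epsilon>; the events
    with a weak inequality are larger and are the ones that \<open>single\<close> bounds.\<close>
  also have "\<dots> \<le> prob (\<Union>r\<in>R. {\<omega> \<in> space M. D r \<omega> \<ge> \<epsilon>})"
    using B R by (intro finite_measure_mono) (auto simp: not_le intro: less_imp_le)
  also have "\<dots> \<le> (\<Sum>r\<in>R. prob {\<omega> \<in> space M. D r \<omega> \<ge> \<epsilon>})"
    using B R by (intro finite_measure_subadditive_finite) auto
  also have "\<dots> \<le> (\<Sum>r\<in>R. \<alpha> / card R)"
    by (intro sum_mono single)
  also have "\<dots> = \<alpha>"
    using cR by simp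
  finally show ?thesis
    by (simp add: D_def \<epsilon>_def)
qed

lemma zero_off_measurable:
  assumes "is_interval I" "continuous_on I G"
  shows "zero_off I G \<in> borel_measurable borel"
  using borel_measurable_continuous_on_if[OF real_interval_borel_measurable[OF assms(1)] assms(2)]
  by (simp add: zero_off_def [abs_def])

lemma zero_off_bounds:
  assumes "bij_betw G I {0<..<1}"
  shows "zero_off I G x \<in> {0..<1}"
  using bij_betwE[OF assms] by (auto simp: zero_off_def less_imp_le)

text \<open>A variable lying almost surely strictly between two constants has its mean strictly
  between them. The upper bound 1 holds at every point, but 0 is the default value off
  \<open>I\<close>, so positivity holds only almost surely. Strictness puts the moment in the range
  of \<open>G\<close>, where \<open>the_inv_into\<close> is a true inverse.\<close>

lemma coord_moment_bounds:
  assumes "prob_space M" "is_interval I" "continuous_on I G" "bij_betw G I {0<..<1}"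
    and X: "X \<in> borel_measurable M" and one: "measure (distr M borel X) I = 1" and r: "r \<ge> 1"
  shows "coord_moment M I G X r \<in> {0<..<1}"
proof -
  interpret prob_space M by fact
  interpret D: prob_space "distr M borel X"
    by (rule prob_space_distr) (rule X)
  have AE: "AE \<omega> in M. X \<omega> \<in> I"
    using D.AE_prob_1[OF one] X real_interval_borel_measurable[OF assms(2)]
    by (subst (asm) AE_distr_iff) auto
  note bnd = zero_off_bounds[OF assms(4)]
  \<comment> \<open>Here \<open>r \<ge> 1\<close> matters: the power with exponent 0 is constantly
    1.\<close>
  have lt1: "zero_off I G x ^ r < 1" for x
    using bnd[of x] r by (intro power_less_one_iff[THEN iffD2]) auto
  have m: "(\<lambda>\<omega>. zero_off I G (X \<omega>) ^ r) \<in> borel_measurable M"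
    using measurable_compose[OF X zero_off_measurable[OF assms(2,3)]] by measurable
  have int: "integrable M (\<lambda>\<omega>. zero_off I G (X \<omega>) ^ r)"
    using bnd lt1 by (intro integrable_const_bound[OF _ m, where B = 1]) (auto intro!: less_imp_le)
  have "AE \<omega> in M. 0 < zero_off I G (X \<omega>) ^ r"
    using AE by eventually_elim (use bij_betwE[OF assms(4)] in \<open>auto simp: zero_off_def\<close>)
  then show ?thesis
    using expectation_greater[OF int] expectation_less[OF int] lt1
    unfolding coord_moment_def by auto
qed

text \<open>A least or greatest element of \<open>I\<close> would be mapped to a least or greatest
  element of the image, and an open interval has neither.\<close>

lemma strict_mono_on_onto_open_no_endpoints:
  fixes G :: "real \<Rightarrow> real"
  assumes mono: "strict_mono_on I G" and onto: "G ` I = {a<..<b}" and x: "x \<in> I"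
  shows "Inf (ereal ` I) < ereal x" and "ereal x < Sup (ereal ` I)"
proof -
  have Gx: "a < G x" "G x < b"
    using x onto by auto
  \<comment> \<open>By density there is a value strictly between \<open>a\<close> and
    \<open>G x\<close>, and \<open>y\<close> is a preimage of it; \<open>z\<close> arises in the
    same way between \<open>G x\<close> and \<open>b\<close>.\<close>
  obtain y where y: "y \<in> I" "G y < G x"
    using dense[OF Gx(1)] Gx onto by (metis greaterThanLessThan_iff imageE order.strict_trans)
  obtain z where z: "z \<in> I" "G x < G z"
    using dense[OF Gx(2)] Gx onto by (metis greaterThanLessThan_iff imageE order.strict_trans)
  have "y < x" "x < z"
    using strict_mono_on_less[OF mono] x y z by auto
  then show "Inf (ereal ` I) < ereal x" "ereal x < Sup (ereal ` I)"
    using y z by (auto simp: Inf_less_iff less_Sup_iff)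
qed

lemma ext_inv_inj:
  assumes mono: "strict_mono_on I G" and bij: "bij_betw G I {0<..<1}"
    and p: "p \<in> {0<..<1}" and u: "u \<in> {0..1}"
  shows "ereal (the_inv_into I G p) = ext_inv I G u \<longleftrightarrow> u = p"
proof -
  have onto: "G ` I = {0<..<1}" and inj: "inj_on G I"
    using bij by (auto simp: bij_betw_def)
  have "the_inv_into I G p \<in> I"
    using the_inv_into_into[OF inj _ subset_refl] p onto by simp
  note ends = strict_mono_on_onto_open_no_endpoints[OF mono onto this]
  \<comment> \<open>Applying \<open>G\<close> to both sides recovers \<open>p\<close> and
    \<open>u\<close>. At 0 and 1 there is no preimage; those cases compare a point of
    \<open>I\<close> with the infimum or supremum and are settled by \<open>ends\<close>.\<close>
  have "the_inv_into I G p = the_inv_into I G u \<longleftrightarrow> u = p" if "u \<in> {0<..<1}"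
    using f_the_inv_into_f_bij_betw[OF bij] that p by metis
  then show ?thesis
    using ends p u by (auto simp: ext_inv_def)
qed

theorem proposition6p5:
  fixes M :: "'a measure" and P :: "real measure"
    and I :: "real set" and G :: "real \<Rightarrow> real"
    and X :: "'a \<Rightarrow> real" and Xs :: "nat \<Rightarrow> 'a \<Rightarrow> real"
    and n q :: nat and \<alpha> :: real
  assumes "prob_space M"
    and "is_interval I"
    and "continuous_on I G" and "strict_mono_on I G" and "bij_betw G I {0<..<1}"
    and "n \<ge> 1"
    and "prob_space.indep_vars M (\<lambda>_. borel) (\<lambda>i. if i = 0 then X else Xs i) {0..n}"
    and "distr M borel X = P" and "\<And>i. i \<in> {1..n} \<Longrightarrow> distr M borel (Xs i) = P"
    and "measure P I = 1"
    and "q \<ge> 1"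
    and "0 < \<alpha>" and "\<alpha> < 1"
  shows "measure M {\<omega> \<in> space M. \<forall>r\<in>{1..q}.
             \<bar>emp_moment I G Xs n r \<omega> - coord_moment M I G X r\<bar> \<le> conf_radius n \<alpha> q} \<ge> 1 - \<alpha>
       \<and> measure M {\<omega> \<in> space M. \<forall>r\<in>{1..q}.
             coord_moment M I G X r \<in> conf_interval I G Xs n \<alpha> q r \<omega>} \<ge> 1 - \<alpha>
       \<and> measure M {\<omega> \<in> space M. \<forall>r\<in>{1..q}.
             ereal (kolm_moment M I G X r) \<in> ext_inv I G ` conf_interval I G Xs n \<alpha> q r \<omega>} \<ge> 1 - \<alpha>"
proof -
  interpret prob_space M by fact
  have X: "X \<in> borel_measurable M"
    using assms(7) unfolding indep_vars_def by force
  \<comment> \<open>Index 0 carries the generic copy \<open>X\<close>, which enters only through its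
    law; the averages run over the remaining indices.\<close>
  have "indep_vars (\<lambda>_. borel) (\<lambda>i. if i = 0 then X else Xs i) {1..n}"
    using assms(7) by (rule indep_vars_subset) auto
  then have indep: "indep_vars (\<lambda>_. borel) Xs {1..n}"
    by (subst (asm) indep_vars_cong[where J = "{1..n}" and Y = Xs]) auto
  note bnd = zero_off_bounds[OF assms(5)]
  have p: "coord_moment M I G X r \<in> {0<..<1}" if "r \<in> {1..q}" for r
    using coord_moment_bounds[OF assms(1,2,3,5) X] assms(8,10) that by simp
  have "prob {\<omega> \<in> space M. \<forall>r\<in>{1..q}. \<bar>(\<Sum>i\<in>{1..n}. zero_off I G (Xs i \<omega>) ^ r) / card {1..n}
             - expectation (\<lambda>\<omega>. zero_off I G (X \<omega>) ^ r)\<bar>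
           \<le> sqrt (ln (2 * card {1..q} / \<alpha>) / (2 * card {1..n}))} \<ge> 1 - \<alpha>"
  proof (rule Hoeffding_simultaneous[OF indep _ _ X])
    show "distr M borel (Xs i) = distr M borel X" if "i \<in> {1..n}" for i
      using assms(8,9) that by simp
    show "(\<lambda>x. zero_off I G x ^ r) \<in> borel_measurable borel" for r
      using zero_off_measurable[OF assms(2,3)] by measurable
    show "zero_off I G x ^ r \<in> {0..1}" for r x
      using bnd[of x] by (auto intro: power_le_one less_imp_le)
  qed (use assms in auto)
  then have first: "prob {\<omega> \<in> space M. \<forall>r\<in>{1..q}.
      \<bar>emp_moment I G Xs n r \<omega> - coord_moment M I G X r\<bar> \<le> conf_radius n \<alpha> q} \<ge> 1 - \<alpha>"
    by (simp add: emp_moment_def coord_moment_def conf_radius_def)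
  \<comment> \<open>Cutting the interval down to [0,1] cannot lose the true moment, which lies there
    by \<open>p\<close>.\<close>
  have second: "coord_moment M I G X r \<in> conf_interval I G Xs n \<alpha> q r \<omega> \<longleftrightarrow>
      \<bar>emp_moment I G Xs n r \<omega> - coord_moment M I G X r\<bar> \<le> conf_radius n \<alpha> q"
    if "r \<in> {1..q}" for r \<omega>
    using p[OF that] by (auto simp: conf_interval_def abs_le_iff)
  \<comment> \<open>The same cut keeps every candidate \<open>u\<close> in [0,1], as
    \<open>ext_inv_inj\<close> demands. Both equivalences hold for every \<omega>, so the three
    events are equal as sets and the last two inherit the bound.\<close>
  have third: "ereal (kolm_moment M I G X r) \<in> ext_inv I G ` conf_interval I G Xs n \<alpha> q r \<omega> \<longleftrightarrow>
      coord_moment M I G X r \<in> conf_interval I G Xs n \<alpha> q r \<omega>" if "r \<in> {1..q}" for r \<omega>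
    using ext_inv_inj[OF assms(4,5) p[OF that]]
    by (auto simp: kolm_moment_def image_iff conf_interval_def)
  show ?thesis
    using first by (simp only: second third simp_thms cong: ball_cong)
qed

end
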